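(* Let $B$ and $C$ be two-qubit gates with Cartan coordinates $(x,y,z)$ and $(x',y',z')$ respectively. Say that $B$ and $C$ together synthesize SWAP in 2 layers if there exist single-qubit gates $a,b,c,d,e,f\in SU(2)$ such that, up to a global phase, $$\mathrm{SWAP} = (e\otimes f)\, C\, (c\otimes d)\, B\, (a\otimes b).$$ Then: (i) $B$ and $C$ together synthesize SWAP in 2 layers if and only if $B$ is locally equivalent to $C^\dagger\,\mathrm{SWAP}$, equivalently, if and only if $$(x,y,z)\sim \left(\tfrac12-x',\ \tfrac12-y',\ \tfrac12-z'\right).$$ (ii) For every local equivalence class $[B]$ of two-qubit gates there is exactly one local equivalence class $[C]$ of two-qubit gates such that $[B]$ and $[C]$ together synthesize SWAP in 2 layers (that is, such that representatives $B$ of $[B]$ and $C$ of $[C]$ together synthesize SWAP in 2 layers).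
   Context: A two-qubit gate is a $4\times 4$ unitary matrix acting on $\mathbb{C}^2\otimes\mathbb{C}^2$, considered up to a global phase (so it can be represented by an element of $SU(4)$). SWAP is the gate with $\mathrm{SWAP}(u\otimes v)=v\otimes u$ for all $u,v\in\mathbb{C}^2$. Let $X,Y,Z$ denote the $2\times 2$ Pauli matrices. Two two-qubit gates $U_1,U_2$ are locally equivalent if, up to a global phase, $U_1=k_1U_2k_2$ for some $k_1,k_2\in SU(2)\otimes SU(2)$ (i.e. $k_1,k_2$ of the form $p\otimes q$ with $p,q\in SU(2)$). $[U]$ denotes the local equivalence class of $U$. For $t=(t_x,t_y,t_z)\in\mathbb{R}^3$ put $$N(t)=\exp\left(-i\tfrac{\pi}{2}\left(t_x X\otimes X+t_y Y\otimes Y+t_z Z\otimes Z\right)\right).$$ Every two-qubit gate $U$ can be written, up to a global phase, as $U=k_1N(t)k_2$ with $k_1,k_2\in SU(2)\otimes SU(2)$ (Cartan decomposition); any such triple $t$ is called Cartan coordinates of $U$. Cartan coordinates are not unique. For $s,t\in\mathbb{R}^3$, write $s\sim t$ ("equal up to canonicalization") if $N(s)$ and $N(t)$ are locally equivalent, i.e. $s$ and $t$ are Cartan coordinates of the same local equivalence class. *)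

theory Defs
  imports "HOL-Analysis.Analysis"
begin

text \<open>
  The space $C^2 \otimes C^2$ is \<open>complex ^ (2 \<times> 2)\<close>: the basis vector indexed by the pair
  \<open>(i, j)\<close> is $e_i \otimes e_j$.
\<close>

type_synonym cmat2 = "complex ^ 2 ^ 2"
type_synonym cmat4 = "complex ^ (2 \<times> 2) ^ (2 \<times> 2)"

definition smult_mat :: "complex \<Rightarrow> complex ^ 'n ^ 'm \<Rightarrow> complex ^ 'n ^ 'm" where
  "smult_mat c A = (\<chi> i j. c * A $ i $ j)"

definition dagger :: "complex ^ 'n ^ 'm \<Rightarrow> complex ^ 'm ^ 'n" where
  "dagger A = (\<chi> i j. cnj (A $ j $ i))"

definition unitary_mat :: "complex ^ 'n ^ 'n \<Rightarrow> bool" where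
  "unitary_mat A \<longleftrightarrow> dagger A ** A = mat 1 \<and> A ** dagger A = mat 1"

definition SU2 :: "cmat2 set" where
  "SU2 = {A. unitary_mat A \<and> det A = 1}"

definition tensor_vec :: "complex ^ 2 \<Rightarrow> complex ^ 2 \<Rightarrow> complex ^ (2 \<times> 2)" where
  "tensor_vec u v = (\<chi> p. u $ fst p * v $ snd p)"

definition tensor_mat :: "cmat2 \<Rightarrow> cmat2 \<Rightarrow> cmat4" where
  "tensor_mat A B = (\<chi> p q. A $ fst p $ fst q * B $ snd p $ snd q)"

lemma tensor_mat_mult_tensor_vec:
  "tensor_mat A B *v tensor_vec u v = tensor_vec (A *v u) (B *v v)"
  by (simp add: tensor_mat_def tensor_vec_def matrix_vector_mult_def vec_eq_iff
      sum_product sum.cartesian_product UNIV_Times_UNIV[symmetric] case_prod_unfold ac_simps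
      del: UNIV_Times_UNIV)

definition local_gates :: "cmat4 set" where
  "local_gates = {tensor_mat p q | p q. p \<in> SU2 \<and> q \<in> SU2}"

text \<open>
  A two-qubit gate is represented by a unitary matrix; all notions below that concern gates are
  invariant under multiplying such a representative by a global phase.
\<close>

definition gates :: "cmat4 set" where
  "gates = {U. unitary_mat U}"

definition phase_eq :: "cmat4 \<Rightarrow> cmat4 \<Rightarrow> bool" where
  "phase_eq U V \<longleftrightarrow> (\<exists>w. cmod w = 1 \<and> U = smult_mat w V)"

definition SWAP :: cmat4 where
  "SWAP = (\<chi> p q. if fst p = snd q \<and> snd p = fst q then 1 else 0)"

lemma SWAP_tensor_vec: "SWAP *v tensor_vec u v = tensor_vec v u"
proof -
  have "(\<Sum>q\<in>UNIV. (if fst p = snd q \<and> snd p = fst q then 1 else 0) * (u $ fst q * v $ snd q))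
      = v $ fst p * u $ snd p" for p :: "2 \<times> 2"
  proof -
    have "(if fst p = snd q \<and> snd p = fst q then 1 else 0) * (u $ fst q * v $ snd q)
        = (if q = (snd p, fst p) then u $ fst q * v $ snd q else 0)" for q
      by (auto simp: prod_eq_iff)
    then show ?thesis by simp
  qed
  then show ?thesis
    by (simp add: SWAP_def tensor_vec_def matrix_vector_mult_def vec_eq_iff)
qed

definition pauli_X :: cmat2 where
  "pauli_X = vector [vector [0, 1], vector [1, 0]]"

definition pauli_Y :: cmat2 where
  "pauli_Y = vector [vector [0, - \<i>], vector [\<i>, 0]]"

definition pauli_Z :: cmat2 where
  "pauli_Z = vector [vector [1, 0], vector [0, - 1]]"

text \<open>
  The library instances of \<open>*\<close>, \<open>^\<close> and \<open>1\<close> on vectors are componentwise, so the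
  exponential series of the matrix product is written out with \<open>**\<close>.
\<close>

primrec mat_pow :: "complex ^ 'n ^ 'n \<Rightarrow> nat \<Rightarrow> complex ^ 'n ^ 'n" where
  "mat_pow A 0 = mat 1"
| "mat_pow A (Suc n) = A ** mat_pow A n"

definition mat_exp :: "complex ^ 'n ^ 'n \<Rightarrow> complex ^ 'n ^ 'n" where
  "mat_exp A = (\<Sum>n. (1 / fact n) *\<^sub>R mat_pow A n)"

definition Ngate :: "real \<times> real \<times> real \<Rightarrow> cmat4" where
  "Ngate = (\<lambda>(tx, ty, tz). mat_exp (smult_mat (- \<i> * (pi / 2))
     (smult_mat tx (tensor_mat pauli_X pauli_X)
      + smult_mat ty (tensor_mat pauli_Y pauli_Y)
      + smult_mat tz (tensor_mat pauli_Z pauli_Z))))"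

definition locally_equiv :: "cmat4 \<Rightarrow> cmat4 \<Rightarrow> bool" where
  "locally_equiv U V \<longleftrightarrow> (\<exists>k1\<in>local_gates. \<exists>k2\<in>local_gates. phase_eq U (k1 ** V ** k2))"

definition local_classes :: "cmat4 set set" where
  "local_classes = gates // {(U, V). U \<in> gates \<and> V \<in> gates \<and> locally_equiv U V}"

definition cartan_coords :: "cmat4 \<Rightarrow> real \<times> real \<times> real \<Rightarrow> bool" where
  "cartan_coords U t \<longleftrightarrow>
     (\<exists>k1\<in>local_gates. \<exists>k2\<in>local_gates. phase_eq U (k1 ** Ngate t ** k2))"

definition canon_eq :: "real \<times> real \<times> real \<Rightarrow> real \<times> real \<times> real \<Rightarrow> bool" where
  "canon_eq s t \<longleftrightarrow> locally_equiv (Ngate s) (Ngate t)"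

definition synthesize_SWAP :: "cmat4 \<Rightarrow> cmat4 \<Rightarrow> bool" where
  "synthesize_SWAP B C \<longleftrightarrow>
     (\<exists>a\<in>SU2. \<exists>b\<in>SU2. \<exists>c\<in>SU2. \<exists>d\<in>SU2. \<exists>e\<in>SU2. \<exists>f\<in>SU2.
        phase_eq SWAP
          (tensor_mat e f ** C ** tensor_mat c d ** B ** tensor_mat a b))"

end

theory Submission
  imports Defs
begin

text \<open>
  Conjugation by SWAP permutes the two tensor factors, so a local gate moves through SWAP to another
  local gate. Hence the equation for SWAP can be solved for $B$, which gives $B \sim C^\dagger$ SWAP,
  and equally for $C$, which determines its class. All $N(t)$ and SWAP are diagonal in the Bell
  basis, and comparing eigenvalues there shows that $N(t)^\dagger$ SWAP is
  $N(1/2 - t_x, 1/2 - t_y, 1/2 - t_z)$ up to a phase.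
\<close>

section \<open>Scalars, adjoints and unitarity\<close>

lemma smult_mat_smult_mat: "smult_mat a (smult_mat b A) = smult_mat (a * b) A"
  by (simp add: smult_mat_def vec_eq_iff)

lemma smult_mat_1: "smult_mat 1 A = A"
  by (simp add: smult_mat_def vec_eq_iff)

lemma smult_mat_mult_left: "smult_mat c A ** B = smult_mat c (A ** B)"
  by (simp add: smult_mat_def matrix_matrix_mult_def vec_eq_iff sum_distrib_left mult.assoc)

lemma smult_mat_mult_right: "A ** smult_mat c B = smult_mat c (A ** B)"
  by (simp add: smult_mat_def matrix_matrix_mult_def vec_eq_iff sum_distrib_left ac_simps)

lemma dagger_dagger: "dagger (dagger A) = A"
  by (simp add: dagger_def vec_eq_iff)

lemma dagger_mult: "dagger (A ** B) = dagger B ** dagger A"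
  by (simp add: dagger_def matrix_matrix_mult_def vec_eq_iff mult.commute)

lemma dagger_smult_mat: "dagger (smult_mat c A) = smult_mat (cnj c) (dagger A)"
  by (simp add: dagger_def smult_mat_def vec_eq_iff)

lemma dagger_mat_1: "dagger (mat 1) = mat 1"
  by (simp add: dagger_def mat_def vec_eq_iff)

lemma unitary_mat_mult: "unitary_mat A \<Longrightarrow> unitary_mat B \<Longrightarrow> unitary_mat (A ** B)"
  unfolding unitary_mat_def dagger_mult
  by (metis matrix_mul_assoc matrix_mul_rid)

lemma unitary_mat_dagger: "unitary_mat A \<Longrightarrow> unitary_mat (dagger A)"
  by (simp add: unitary_mat_def dagger_dagger)

lemma unitary_mat_1: "unitary_mat (mat 1)"
  by (simp add: unitary_mat_def dagger_mat_1)

lemma unitary_mat_cancel: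
  assumes "unitary_mat A"
  shows "A ** (dagger A ** B) = B" and "dagger A ** (A ** B) = B"
  using assms by (simp_all add: unitary_mat_def matrix_mul_assoc)

lemma SU2_mult: "A \<in> SU2 \<Longrightarrow> B \<in> SU2 \<Longrightarrow> A ** B \<in> SU2"
  by (simp add: SU2_def unitary_mat_mult det_mul)

lemma det_dagger_2: "det (dagger (A :: cmat2)) = cnj (det A)"
  by (simp add: det_2 dagger_def mult.commute)

lemma SU2_dagger: "A \<in> SU2 \<Longrightarrow> dagger A \<in> SU2"
  by (simp add: SU2_def unitary_mat_dagger det_dagger_2)

lemma SU2_1: "mat 1 \<in> SU2"
  by (simp add: SU2_def unitary_mat_1)

text \<open>Rewrites a sum over pairs to the shape expected by \<open>sum.cartesian_product\<close>.
  Its uses delete \<open>UNIV_Times_UNIV\<close>, which rewrites in the opposite direction.\<close>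

lemma UNIV_pair: "(UNIV :: ('a \<times> 'b) set) = UNIV \<times> UNIV"
  by simp

lemma tensor_mat_mult: "tensor_mat A B ** tensor_mat A' B' = tensor_mat (A ** A') (B ** B')"
  by (simp add: tensor_mat_def matrix_matrix_mult_def vec_eq_iff UNIV_pair
      sum_product sum.cartesian_product case_prod_unfold ac_simps del: UNIV_Times_UNIV)

lemma dagger_tensor_mat: "dagger (tensor_mat A B) = tensor_mat (dagger A) (dagger B)"
  by (simp add: tensor_mat_def dagger_def vec_eq_iff)

lemma tensor_mat_1: "tensor_mat (mat 1) (mat 1) = mat 1"
  by (simp add: tensor_mat_def mat_def vec_eq_iff prod_eq_iff)

lemma local_gates_mult: "k \<in> local_gates \<Longrightarrow> l \<in> local_gates \<Longrightarrow> k ** l \<in> local_gates"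
  unfolding local_gates_def using tensor_mat_mult SU2_mult by fastforce

lemma local_gates_dagger: "k \<in> local_gates \<Longrightarrow> dagger k \<in> local_gates"
  unfolding local_gates_def using dagger_tensor_mat SU2_dagger by fastforce

lemma local_gates_1: "mat 1 \<in> local_gates"
  unfolding local_gates_def using tensor_mat_1 SU2_1 by (metis (mono_tags, lifting) mem_Collect_eq)

lemma local_gates_unitary: "k \<in> local_gates \<Longrightarrow> unitary_mat k"
  by (auto simp: local_gates_def SU2_def unitary_mat_def dagger_tensor_mat tensor_mat_mult tensor_mat_1)

section \<open>Matrices diagonal in the Bell basis, and the gates $N(t)$\<close>

lemma sum_UNIV_2x2:
  "(\<Sum>p\<in>UNIV. f (p :: 2 \<times> 2)) = f (1, 1) + f (1, 2) + f (2, 1) + f (2, 2)"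
proof -
  have "(\<Sum>p\<in>UNIV. f (p :: 2 \<times> 2)) = (\<Sum>i\<in>UNIV. \<Sum>j\<in>UNIV. f (i, j))"
    by (simp add: sum.cartesian_product UNIV_pair del: UNIV_Times_UNIV)
  then show ?thesis
    by (simp add: sum_2 add.assoc)
qed

text \<open>
  The matrix with eigenvalues \<open>a, b, c, d\<close> on the Bell basis
  $e_{11} + e_{22}$, $e_{11} - e_{22}$, $e_{12} + e_{21}$, $e_{12} - e_{21}$.
\<close>

definition bell_diag :: "complex \<Rightarrow> complex \<Rightarrow> complex \<Rightarrow> complex \<Rightarrow> cmat4" where
  "bell_diag a b c d = (\<chi> p q.
     if fst p = snd p
     then (if q = p then (a + b) / 2 else if fst q = snd q then (a - b) / 2 else 0)
     else (if q = p then (c + d) / 2 else if fst q = snd q then 0 else (c - d) / 2))"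

text \<open>Reduces a matrix identity to sixteen scalar ones at concrete indices, where the case
  distinctions of \<open>bell_diag\<close> evaluate.\<close>

lemma cmat4_eq_iff:
  "(A :: cmat4) = B \<longleftrightarrow>
     (\<forall>p\<in>{(1, 1), (1, 2), (2, 1), (2, 2)}. \<forall>q\<in>{(1, 1), (1, 2), (2, 1), (2, 2)}. A $ p $ q = B $ p $ q)"
  by (simp add: vec_eq_iff forall_2)

lemma bell_diag_mult:
  "bell_diag a b c d ** bell_diag a' b' c' d' = bell_diag (a * a') (b * b') (c * c') (d * d')"
  by (simp add: bell_diag_def matrix_matrix_mult_def cmat4_eq_iff sum_UNIV_2x2 field_simps)

lemma bell_diag_1: "bell_diag 1 1 1 1 = mat 1"
  by (simp add: bell_diag_def mat_def cmat4_eq_iff)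

lemma smult_mat_bell_diag:
  "smult_mat w (bell_diag a b c d) = bell_diag (w * a) (w * b) (w * c) (w * d)"
  by (simp add: bell_diag_def smult_mat_def cmat4_eq_iff field_simps)

lemma dagger_bell_diag:
  "dagger (bell_diag a b c d) = bell_diag (cnj a) (cnj b) (cnj c) (cnj d)"
  by (simp add: bell_diag_def dagger_def cmat4_eq_iff)

text \<open>The first three Bell vectors are symmetric under exchange of the factors; the singlet is
  antisymmetric.\<close>

lemma SWAP_eq_bell_diag: "SWAP = bell_diag 1 1 1 (-1)"
  by (simp add: bell_diag_def SWAP_def cmat4_eq_iff)

lemma mat_pow_bell_diag:
  "mat_pow (bell_diag a b c d) n = bell_diag (a ^ n) (b ^ n) (c ^ n) (d ^ n)"
  by (induction n) (simp_all add: bell_diag_1 bell_diag_mult)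

text \<open>The entries of \<open>bell_diag\<close> are linear in the eigenvalues, so partial sums
  can be taken inside, and convergence of matrices is entrywise.\<close>

lemma bell_diag_sums:
  assumes "f sums a" "g sums b" "h sums c" "k sums d"
  shows "(\<lambda>n. bell_diag (f n) (g n) (h n) (k n)) sums bell_diag a b c d"
proof -
  have partial: "(\<Sum>i<n. bell_diag (f i) (g i) (h i) (k i))
      = bell_diag (\<Sum>i<n. f i) (\<Sum>i<n. g i) (\<Sum>i<n. h i) (\<Sum>i<n. k i)" for n
    by (simp add: bell_diag_def cmat4_eq_iff sum.distrib sum_subtractf
        sum_divide_distrib[symmetric])
  show ?thesis
    unfolding sums_def partial unfolding bell_diag_def
    by (intro vec_tendstoI) (use assms in \<open>auto simp: sums_def intro!: tendsto_intros\<close>)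
qed

lemma mat_exp_bell_diag:
  "mat_exp (bell_diag a b c d) = bell_diag (exp a) (exp b) (exp c) (exp d)"
proof -
  have scale: "r *\<^sub>R bell_diag a b c d = bell_diag (r *\<^sub>R a) (r *\<^sub>R b) (r *\<^sub>R c) (r *\<^sub>R d)"
    for r a b c d
    by (simp add: bell_diag_def cmat4_eq_iff scaleR_conv_of_real[where 'a = complex] field_simps)
  have exp_sums: "(\<lambda>n. (1 / fact n) *\<^sub>R z ^ n) sums exp z" for z :: complex
    using exp_converges[of z] by (simp add: inverse_eq_divide)
  show ?thesis
    unfolding mat_exp_def mat_pow_bell_diag scale
    by (intro sums_unique[symmetric] bell_diag_sums exp_sums)
qed

text \<open>The three Pauli products commute and have the Bell vectors as common eigenvectors. Their
  signs, in the order X, Y, Z, are (+,-,+), (-,+,+), (+,+,-) and (-,-,-).\<close>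

lemma pauli_sum_eq_bell_diag:
  "smult_mat x (tensor_mat pauli_X pauli_X) + smult_mat y (tensor_mat pauli_Y pauli_Y)
     + smult_mat z (tensor_mat pauli_Z pauli_Z)
   = bell_diag (x - y + z) (- x + y + z) (x + y - z) (- x - y - z)"
  by (simp add: bell_diag_def smult_mat_def tensor_mat_def pauli_X_def pauli_Y_def pauli_Z_def
      cmat4_eq_iff field_simps)

lemma Ngate_eq_bell_diag:
  "Ngate (x, y, z) = bell_diag (cis (- (pi / 2) * (x - y + z))) (cis (- (pi / 2) * (- x + y + z)))
     (cis (- (pi / 2) * (x + y - z))) (cis (- (pi / 2) * (- x - y - z)))"
  unfolding Ngate_def prod.case pauli_sum_eq_bell_diag smult_mat_bell_diag mat_exp_bell_diag
  by (simp add: cis_conv_exp algebra_simps)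

text \<open>On the singlet, the last Bell vector, the exponent at $(1/2, 1/2, 1/2)$ differs from that
  on the other three by $i\pi$, so $N(1/2, 1/2, 1/2)$ is SWAP up to the phase $e^{-i\pi/4}$.\<close>

lemma dagger_Ngate_SWAP:
  "Ngate (1/2 - x, 1/2 - y, 1/2 - z) = smult_mat (cis (- (pi / 4))) (dagger (Ngate (x, y, z)) ** SWAP)"
proof -
  \<comment> \<open>The eigenvalue -1 of SWAP on the singlet is absorbed into the angle, so that
    each eigenvalue becomes a single \<open>cis\<close> and the angles agree exactly.\<close>
  have minus: "- cis t = cis (t + pi)" for t
    by (simp add: cis_mult[symmetric])
  show ?thesis
    unfolding Ngate_eq_bell_diag dagger_bell_diag SWAP_eq_bell_diag bell_diag_mult
      smult_mat_bell_diag
    by (simp add: cis_cnj cis_mult minus algebra_simps add_divide_distrib diff_divide_distrib)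
qed

section \<open>SWAP and local gates\<close>

lemma dagger_SWAP: "dagger SWAP = SWAP"
  by (simp add: SWAP_eq_bell_diag dagger_bell_diag)

lemma SWAP_SWAP: "SWAP ** SWAP = mat 1"
  by (simp add: SWAP_eq_bell_diag bell_diag_mult bell_diag_1)

lemma SWAP_in_gates: "SWAP \<in> gates"
  by (simp add: gates_def unitary_mat_def dagger_SWAP SWAP_SWAP)

lemma tensor_mat_SWAP: "tensor_mat A B ** SWAP = SWAP ** tensor_mat B A"
  by (simp add: tensor_mat_def SWAP_def matrix_matrix_mult_def cmat4_eq_iff sum_UNIV_2x2)

lemma local_gates_SWAP:
  assumes "k \<in> local_gates"
  obtains l where "l \<in> local_gates" "k ** SWAP = SWAP ** l"
  using assms unfolding local_gates_def by (force simp: tensor_mat_SWAP)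

section \<open>Local equivalence and its compatibility with adjoints and SWAP\<close>

lemma locally_equivI:
  "\<lbrakk>k \<in> local_gates; l \<in> local_gates; cmod w = 1; U = smult_mat w (k ** V ** l)\<rbrakk>
     \<Longrightarrow> locally_equiv U V"
  unfolding locally_equiv_def phase_eq_def by blast

lemma locally_equivE:
  assumes "locally_equiv U V"
  obtains k l w where "k \<in> local_gates" "l \<in> local_gates" "cmod w = 1"
    "U = smult_mat w (k ** V ** l)"
  using assms unfolding locally_equiv_def phase_eq_def by blast

lemma locally_equiv_phase: "cmod w = 1 \<Longrightarrow> locally_equiv (smult_mat w U) U"
  by (rule locally_equivI[OF local_gates_1 local_gates_1]) simp_all

lemma locally_equiv_refl: "locally_equiv U U"
  using locally_equiv_phase[of 1 U] by (simp add: smult_mat_1)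

lemma locally_equiv_sym:
  assumes "locally_equiv U V"
  shows "locally_equiv V U"
proof -
  obtain k l w where kl: "k \<in> local_gates" "l \<in> local_gates" and w: "cmod w = 1"
    and U: "U = smult_mat w (k ** V ** l)"
    using assms by (rule locally_equivE)
  have "cnj w * w = 1"
    using w by (simp add: complex_norm_square[symmetric] mult.commute)
  then have "V = smult_mat (cnj w) (dagger k ** U ** dagger l)"
    using local_gates_unitary[OF kl(1)] local_gates_unitary[OF kl(2)]
    by (simp add: U smult_mat_mult_left smult_mat_mult_right smult_mat_smult_mat smult_mat_1
        matrix_mul_assoc[symmetric] unitary_mat_cancel unitary_mat_def)
  then show ?thesis
    using kl w by (intro locally_equivI[of "dagger k" "dagger l" "cnj w"]) (auto simp: local_gates_dagger)
qed

lemma locally_equiv_trans: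
  assumes "locally_equiv U V" "locally_equiv V W"
  shows "locally_equiv U W"
proof -
  obtain k l w where 1: "k \<in> local_gates" "l \<in> local_gates" "cmod w = 1"
    "U = smult_mat w (k ** V ** l)"
    using assms(1) by (rule locally_equivE)
  obtain k' l' w' where 2: "k' \<in> local_gates" "l' \<in> local_gates" "cmod w' = 1"
    "V = smult_mat w' (k' ** W ** l')"
    using assms(2) by (rule locally_equivE)
  show ?thesis
    by (rule locally_equivI[of "k ** k'" "l' ** l" "w * w'"])
      (use 1 2 in \<open>simp_all add: local_gates_mult norm_mult smult_mat_mult_left
        smult_mat_mult_right smult_mat_smult_mat matrix_mul_assoc\<close>)
qed

lemma locally_equiv_dagger:
  assumes "locally_equiv U V"
  shows "locally_equiv (dagger U) (dagger V)"
proof -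
  obtain k l w where "k \<in> local_gates" "l \<in> local_gates" "cmod w = 1"
    "U = smult_mat w (k ** V ** l)"
    using assms by (rule locally_equivE)
  then show ?thesis
    by (intro locally_equivI[of "dagger l" "dagger k" "cnj w"])
      (simp_all add: local_gates_dagger dagger_smult_mat dagger_mult matrix_mul_assoc)
qed

text \<open>The right local factor passes through SWAP, so right multiplication by SWAP is well
  defined on classes.\<close>

lemma locally_equiv_SWAP:
  assumes "locally_equiv U V"
  shows "locally_equiv (U ** SWAP) (V ** SWAP)"
proof -
  obtain k l w where 1: "k \<in> local_gates" "l \<in> local_gates" "cmod w = 1"
    "U = smult_mat w (k ** V ** l)"
    using assms by (rule locally_equivE)
  obtain l' where 2: "l' \<in> local_gates" "l ** SWAP = SWAP ** l'"
    using 1(2) by (rule local_gates_SWAP)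
  have "U ** SWAP = smult_mat w (k ** (V ** SWAP) ** l')"
    using 2(2) by (simp add: 1(4) smult_mat_mult_left matrix_mul_assoc[symmetric])
  then show ?thesis
    using 1 2 by (intro locally_equivI[of k l' w])
qed

section \<open>Synthesis of SWAP in two layers\<close>

lemma synthesize_SWAP_iff_local_gates:
  "synthesize_SWAP B C \<longleftrightarrow> (\<exists>k\<in>local_gates. locally_equiv SWAP (C ** k ** B))"
proof -
  have bex: "(\<exists>k\<in>local_gates. P k) \<longleftrightarrow> (\<exists>p\<in>SU2. \<exists>q\<in>SU2. P (tensor_mat p q))" for P
    unfolding local_gates_def by auto
  show ?thesis
    \<comment> \<open>The outer layers are the two local factors in \<open>locally_equiv\<close>, so
      only the middle layer remains, as \<open>k\<close>.\<close>
    unfolding synthesize_SWAP_def locally_equiv_def bex matrix_mul_assoc by blast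
qed

lemma synthesize_SWAP_iff:
  assumes "B \<in> gates" "C \<in> gates"
  shows "synthesize_SWAP B C \<longleftrightarrow> locally_equiv B (dagger C ** SWAP)"
proof
  assume "synthesize_SWAP B C"
  then obtain k where k: "k \<in> local_gates" and "locally_equiv SWAP (C ** k ** B)"
    unfolding synthesize_SWAP_iff_local_gates by blast
  then have "locally_equiv (C ** k ** B) SWAP"
    by (simp add: locally_equiv_sym)
  then obtain m n w where mn: "m \<in> local_gates" "n \<in> local_gates" and w: "cmod w = 1"
    and eq: "C ** k ** B = smult_mat w (m ** SWAP ** n)"
    by (rule locally_equivE)
  \<comment> \<open>Moving \<open>m\<close> to the right of SWAP leaves nothing between
    \<open>dagger C\<close> and SWAP once \<open>C\<close> is cancelled.\<close>
  obtain m' where m': "m' \<in> local_gates" "m ** SWAP = SWAP ** m'"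
    using mn(1) by (rule local_gates_SWAP)
  have "B = dagger k ** (dagger C ** (C ** k ** B))"
    using assms(2) local_gates_unitary[OF k]
    by (simp add: gates_def matrix_mul_assoc[symmetric] unitary_mat_cancel)
  also have "\<dots> = smult_mat w (dagger k ** (dagger C ** SWAP) ** (m' ** n))"
    unfolding eq m'(2) by (simp add: smult_mat_mult_right matrix_mul_assoc)
  finally show "locally_equiv B (dagger C ** SWAP)"
    using k mn m' w by (intro locally_equivI[of "dagger k" "m' ** n" w])
      (simp_all add: local_gates_dagger local_gates_mult)
next
  assume "locally_equiv B (dagger C ** SWAP)"
  then obtain k l w where kl: "k \<in> local_gates" "l \<in> local_gates" and w: "cmod w = 1"
    and B: "B = smult_mat w (k ** (dagger C ** SWAP) ** l)"
    by (rule locally_equivE)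
  \<comment> \<open>The middle layer \<open>dagger k\<close> cancels the left factor of
    \<open>B\<close>, after which \<open>C\<close> cancels its adjoint. The \<open>mat 1\<close>
    stands for a trivial left factor.\<close>
  have "C ** dagger k ** B = smult_mat w (mat 1 ** SWAP ** l)"
    using assms(2) local_gates_unitary[OF kl(1)]
    by (simp add: B gates_def smult_mat_mult_right matrix_mul_assoc[symmetric] unitary_mat_cancel)
  then have "locally_equiv (C ** dagger k ** B) SWAP"
    using kl w by (intro locally_equivI[of "mat 1" l w]) (simp_all add: local_gates_1)
  then show "synthesize_SWAP B C"
    unfolding synthesize_SWAP_iff_local_gates
    using kl(1) local_gates_dagger locally_equiv_sym by blast
qed

text \<open>Solving for \<open>C\<close> instead of \<open>B\<close> is what gives uniqueness of the
  partner class. Right multiplication by SWAP and the adjoint are involutions that respect local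
  equivalence, so each can be moved across the relation.\<close>

lemma synthesize_SWAP_iff':
  assumes "B \<in> gates" "C \<in> gates"
  shows "synthesize_SWAP B C \<longleftrightarrow> locally_equiv C (dagger (B ** SWAP))"
proof -
  have "locally_equiv B (dagger C ** SWAP) \<longleftrightarrow> locally_equiv (B ** SWAP) (dagger C)"
    using locally_equiv_SWAP[of B "dagger C ** SWAP"] locally_equiv_SWAP[of "B ** SWAP" "dagger C"]
    by (auto simp: matrix_mul_assoc[symmetric] SWAP_SWAP)
  also have "\<dots> \<longleftrightarrow> locally_equiv C (dagger (B ** SWAP))"
    by (metis dagger_dagger locally_equiv_dagger locally_equiv_sym)
  finally show ?thesis
    using assms by (simp add: synthesize_SWAP_iff)
qed

lemma synthesize_SWAP_iff_canon_eq:
  assumes "B \<in> gates" "C \<in> gates" "cartan_coords B (x, y, z)" "cartan_coords C (x', y', z')"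
  shows "synthesize_SWAP B C \<longleftrightarrow> canon_eq (x, y, z) (1/2 - x', 1/2 - y', 1/2 - z')"
proof -
  have B: "locally_equiv B (Ngate (x, y, z))" and C: "locally_equiv C (Ngate (x', y', z'))"
    using assms by (simp_all add: cartan_coords_def locally_equiv_def)
  \<comment> \<open>Together with the next fact, this makes the reflected triple Cartan coordinates
    of \<open>dagger C ** SWAP\<close>; transitivity then compares it with \<open>B\<close>.\<close>
  have "locally_equiv (Ngate (1/2 - x', 1/2 - y', 1/2 - z')) (dagger (Ngate (x', y', z')) ** SWAP)"
    unfolding dagger_Ngate_SWAP by (rule locally_equiv_phase) simp
  moreover have "locally_equiv (dagger C ** SWAP) (dagger (Ngate (x', y', z')) ** SWAP)"
    using C by (intro locally_equiv_SWAP locally_equiv_dagger)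
  ultimately show ?thesis
    unfolding synthesize_SWAP_iff[OF assms(1,2)] canon_eq_def
    using B by (meson locally_equiv_sym locally_equiv_trans)
qed

section \<open>Existence and uniqueness of the partner class\<close>

lemma equiv_locally_equiv:
  "equiv gates {(U, V). U \<in> gates \<and> V \<in> gates \<and> locally_equiv U V}"
  by (rule equivI)
    (auto simp: refl_on_def sym_def trans_def locally_equiv_refl
      intro: locally_equiv_sym locally_equiv_trans)

lemma unique_class_synthesize_SWAP:
  assumes "\<beta> \<in> local_classes"
  shows "\<exists>!\<gamma>. \<gamma> \<in> local_classes \<and> (\<exists>B\<in>\<beta>. \<exists>C\<in>\<gamma>. synthesize_SWAP B C)"
proof -
  let ?R = "{(U, V). U \<in> gates \<and> V \<in> gates \<and> locally_equiv U V}"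
  obtain B where B: "B \<in> gates" and \<beta>: "\<beta> = ?R `` {B}"
    using assms unfolding local_classes_def by (auto elim: quotientE)
  \<comment> \<open>The solution for \<open>C\<close> provided by
    \<open>synthesize_SWAP_iff'\<close>.\<close>
  define D where "D = dagger (B ** SWAP)"
  have D: "D \<in> gates"
    using B SWAP_in_gates by (simp add: D_def gates_def unitary_mat_dagger unitary_mat_mult)
  show ?thesis
  proof (rule ex1I[of _ "?R `` {D}"], intro conjI)
    show "?R `` {D} \<in> local_classes"
      using D unfolding local_classes_def by (rule quotientI)
    have "synthesize_SWAP B D"
      using B D by (simp add: synthesize_SWAP_iff' D_def locally_equiv_refl)
    moreover have "B \<in> \<beta>" "D \<in> ?R `` {D}"
      using B D by (auto simp: \<beta> locally_equiv_refl)
    ultimately show "\<exists>B\<in>\<beta>. \<exists>C\<in>?R `` {D}. synthesize_SWAP B C"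
      by blast
  next
    fix \<gamma> assume "\<gamma> \<in> local_classes \<and> (\<exists>B\<in>\<beta>. \<exists>C\<in>\<gamma>. synthesize_SWAP B C)"
    then obtain B' C where \<gamma>: "\<gamma> \<in> gates // ?R" and B': "B' \<in> \<beta>" and C: "C \<in> \<gamma>"
      and "synthesize_SWAP B' C"
      unfolding local_classes_def by blast
    have Cg: "C \<in> gates"
      using \<gamma> C in_quotient_imp_subset[OF equiv_locally_equiv] by blast
    have "B' \<in> gates" "locally_equiv B' B"
      using B' by (auto simp: \<beta> intro: locally_equiv_sym)
    \<comment> \<open>The class \<open>\<gamma>\<close> may be paired through a representative
      \<open>B'\<close> other than \<open>B\<close>; since SWAP and the adjoint respect local
      equivalence, \<open>C\<close> still lies in the class of \<open>D\<close>.\<close>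
    then have "locally_equiv C (dagger (B' ** SWAP))" "locally_equiv (dagger (B' ** SWAP)) D"
      using \<open>synthesize_SWAP B' C\<close> Cg
      by (simp_all add: synthesize_SWAP_iff' D_def locally_equiv_dagger locally_equiv_SWAP)
    then have "(C, D) \<in> ?R"
      using Cg D by (auto intro: locally_equiv_trans)
    moreover have "D \<in> ?R `` {D}" "?R `` {D} \<in> gates // ?R"
      using D by (simp add: locally_equiv_refl, rule quotientI)
    ultimately show "\<gamma> = ?R `` {D}"
      using quotient_eqI[OF equiv_locally_equiv \<gamma> _ C] by blast
  qed
qed

theorem mainTheorem1:
  shows "(\<forall>B\<in>gates. \<forall>C\<in>gates.
           (synthesize_SWAP B C \<longleftrightarrow> locally_equiv B (dagger C ** SWAP))
         \<and> (\<forall>x y z x' y' z' :: real.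
              cartan_coords B (x, y, z) \<longrightarrow> cartan_coords C (x', y', z') \<longrightarrow>
              (synthesize_SWAP B C \<longleftrightarrow> canon_eq (x, y, z) (1/2 - x', 1/2 - y', 1/2 - z'))))
       \<and> (\<forall>\<beta>\<in>local_classes. \<exists>!\<gamma>. \<gamma> \<in> local_classes
           \<and> (\<exists>B\<in>\<beta>. \<exists>C\<in>\<gamma>. synthesize_SWAP B C))"
  using synthesize_SWAP_iff synthesize_SWAP_iff_canon_eq unique_class_synthesize_SWAP by blast

end
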